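(* Let $u=(u_n)_{n\in\mathbb{N}}$ be a uniformly recurrent infinite word over a finite alphabet $\mathcal{A}$, with language $\mathcal{L}(u)$, factor complexity $\mathcal{C}$ and palindromic complexity $\mathcal{P}$. (i) If $\mathcal{L}(u)$ is not closed under reversal, then $\mathcal{P}(n)=0$ for all sufficiently large $n$. (ii) If $\mathcal{L}(u)$ is closed under reversal, then $$\mathcal{P}(n)+\mathcal{P}(n+1)\leq \Delta\mathcal{C}(n)+2\qquad\text{for all } n\in\mathbb{N},$$ where $\Delta\mathcal{C}(n)=\mathcal{C}(n+1)-\mathcal{C}(n)$.
   Context: $\mathbb{N}=\{0,1,2,\dots\}$. An infinite word over a finite alphabet $\mathcal{A}$ is a sequence $u=(u_n)_{n\in\mathbb{N}}$ with $u_n\in\mathcal{A}$ for all $n$. For $n\in\mathbb{N}$, the set of factors of length $n$ of $u$ is $\mathcal{L}_n(u)=\{w_1\cdots w_n \mid \exists i\in\mathbb{N},\ w_1\cdots w_n=u_iu_{i+1}\cdots u_{i+n-1}\}$ (for $n=0$ it consists of the empty word only), and the language of $u$ is $\mathcal{L}(u)=\bigcup_{n\in\mathbb{N}}\mathcal{L}_n(u)$. The factor complexity is $\mathcal{C}(n)=\#\mathcal{L}_n(u)$. The reversal (mirror image) of a finite word $w=w_1\cdots w_n$ is $\overline{w}=w_n\cdots w_1$. The language $\mathcal{L}(u)$ is closed under reversal if $w\in\mathcal{L}(u)$ implies $\overline{w}\in\mathcal{L}(u)$. The palindromic complexity is $\mathcal{P}(n)=\#\{w\in\mathcal{L}_n(u)\mid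 w=\overline{w}\}$. The word $u$ is uniformly recurrent if for every $n\in\mathbb{N}$ there exists $R(n)\in\mathbb{N}$ such that $\mathcal{L}_n(u)=\{u_iu_{i+1}\cdots u_{i+n-1}\mid k\leq i\leq k+R(n)\}$ for all $k\in\mathbb{N}$ (equivalently, the gaps between consecutive occurrences of any factor in $u$ are bounded). *)

theory Defs
  imports Main "HOL-Library.Omega_Words_Fun"
begin

text \<open>
  An infinite word is a function \<^typ>\<open>nat \<Rightarrow> 'a\<close> (the library's \<^typ>\<open>'a word\<close>), and
  \<^term>\<open>subsequence u i (i + n)\<close> is the finite word
  \<open>u\<^sub>i u\<^sub>i\<^sub>+\<^sub>1 \<dots> u\<^sub>i\<^sub>+\<^sub>n\<^sub>-\<^sub>1\<close>, which is empty for \<open>n = 0\<close>.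
\<close>

definition factors :: "'a word \<Rightarrow> nat \<Rightarrow> 'a list set" where
  "factors u n = {w. \<exists>i. w = subsequence u i (i + n)}"

definition language :: "'a word \<Rightarrow> 'a list set" where
  "language u = (\<Union>n. factors u n)"

definition factor_complexity :: "'a word \<Rightarrow> nat \<Rightarrow> nat" where
  "factor_complexity u n = card (factors u n)"

definition palindromic_complexity :: "'a word \<Rightarrow> nat \<Rightarrow> nat" where
  "palindromic_complexity u n = card {w \<in> factors u n. w = rev w}"

text \<open>The first difference is integer-valued, so that the subtraction is not truncated.\<close>

definition complexity_diff :: "'a word \<Rightarrow> nat \<Rightarrow> int" where
  "complexity_diff u n = int (factor_complexity u (n + 1)) - int (factor_complexity u n)"

definition closed_under_reversal :: "'a list set \<Rightarrow> bool" where
  "closed_under_reversal L \<longleftrightarrow> (\<forall>w\<in>L. rev w \<in> L)"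

definition uniformly_recurrent :: "'a word \<Rightarrow> bool" where
  "uniformly_recurrent u \<longleftrightarrow>
    (\<forall>n. \<exists>R. \<forall>k. factors u n = {subsequence u i (i + n) |i. k \<le> i \<and> i \<le> k + R})"

end

theory Submission
  imports Defs
begin

text \<open>
  (i) By uniform recurrence a given factor \<open>w\<close> lies inside every sufficiently long factor. If
  one of these is a palindrome, the mirror image of that occurrence is an occurrence of \<open>rev w\<close>.
  Hence the existence of arbitrarily long palindromic factors forces closure under reversal.

  (ii) Consider the Rauzy graph of order \<open>n\<close>: its vertices are the factors of length \<open>n\<close>, its
  edges are the factors of length \<open>n + 1\<close>, and an edge joins its prefix to its suffix of length
  \<open>n\<close>. Reversal acts on this graph (inverting orientation), so one may pass to the undirected
  quotient graph, whose vertices and edges are the classes \<open>{w, rev w}\<close>. A finite set \<open>S\<close> of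
  words closed under reversal and containing \<open>p\<close> palindromes has \<open>(card S + p) / 2\<close> classes.
  Reading the infinite word is a walk through the whole quotient graph, so that graph is
  connected, and the number of its edges that are not loops is at least the number of its
  vertices minus one. The prefix and suffix of a palindromic edge are reversals of each other,
  so palindromic edges become loops, and the edges that are not loops number at most
  \<open>(\<C>(n+1) - \<P>(n+1)) / 2\<close>. Therefore
  \<open>(\<C>(n) + \<P>(n)) / 2 \<le> (\<C>(n+1) - \<P>(n+1)) / 2 + 1\<close>, which is the claimed inequality.
  The ingredients are \<open>card_walk_vertices_le\<close> (connectedness) and \<open>card_reversal_classes\<close>
  (counting classes).
\<close>

lemma factors_eq_range: "factors u n = range (\<lambda>i. subsequence u i (i + n))"
  unfolding factors_def by auto

lemma finite_factors:
  assumes "finite A" and "\<And>n. u n \<in> A"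
  shows "finite (factors u n)"
proof (rule finite_subset)
  show "factors u n \<subseteq> {w. set w \<subseteq> A \<and> length w = n}"
    using assms(2) by (auto simp: factors_def subsequence_def)
  show "finite {w. set w \<subseteq> A \<and> length w = n}"
    by (rule finite_lists_length_eq[OF assms(1)])
qed

lemma rev_mem_factors:
  assumes "closed_under_reversal (language u)" and "w \<in> factors u n"
  shows "rev w \<in> factors u n"
proof -
  have "rev w \<in> language u"
    using assms by (auto simp: closed_under_reversal_def language_def)
  then obtain m where m: "rev w \<in> factors u m"
    by (auto simp: language_def)
  have "length w = n" using assms(2) by (auto simp: factors_def)
  moreover have "length w = m" using m by (auto simp: factors_def dest: arg_cong[of _ _ length])
  ultimately show ?thesis using m by simp
qed

lemma infix_mem_language:
  assumes "x @ w @ y \<in> language u"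
  shows "w \<in> language u"
proof -
  obtain i n where eq: "x @ w @ y = map u [i..<i + n]"
    using assms by (auto simp: language_def factors_def subsequence_def)
  have n: "n = length x + length w + length y"
    using arg_cong[OF eq, of length] by simp
  have "w = take (length w) (drop (length x) (x @ w @ y))"
    by simp
  also have "\<dots> = subsequence u (i + length x) (i + length x + length w)"
    unfolding eq by (simp add: take_map drop_map n subsequence_def)
  finally show ?thesis
    by (auto simp: language_def factors_def)
qed

lemma subsequence_split:
  assumes "i \<le> j" and "j \<le> k" and "k \<le> l"
  shows "subsequence u i l = subsequence u i j @ subsequence u j k @ subsequence u k l"
proof -
  have "[i..<l] = [i..<j] @ [j..<k] @ [k..<l]"
    using assms upt_add_eq_append[of i j "l - j"] upt_add_eq_append[of j k "l - k"] by simp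
  then show ?thesis
    by (simp add: subsequence_def)
qed

section \<open>Long palindromes force closure under reversal\<close>

lemma eventually_no_palindromes:
  assumes "uniformly_recurrent u" and "\<not> closed_under_reversal (language u)"
  shows "\<exists>N. \<forall>n\<ge>N. {w \<in> factors u n. w = rev w} = {}"
proof -
  obtain w m where w: "w \<in> factors u m" and rev_w: "rev w \<notin> language u"
    using assms(2) by (auto simp: closed_under_reversal_def language_def)
  obtain R where R: "\<And>k. factors u m = {subsequence u i (i + m) |i. k \<le> i \<and> i \<le> k + R}"
    using assms(1) unfolding uniformly_recurrent_def by blast
  have "p \<noteq> rev p" if p: "p \<in> factors u n" and n: "R + m \<le> n" for n p
  proof
    assume pal: "p = rev p"
    obtain k where k: "p = subsequence u k (k + n)"
      using p by (auto simp: factors_def)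
    obtain i where i: "w = subsequence u i (i + m)" "k \<le> i" "i \<le> k + R"
      using w R[of k] by auto
    obtain x y where "p = x @ w @ y"
      using subsequence_split[of k i "i + m" "k + n" u] i n k by auto
    with pal have "p = rev y @ rev w @ rev x"
      by simp
    moreover have "p \<in> language u"
      using p by (auto simp: language_def)
    ultimately show False
      using infix_mem_language rev_w by metis
  qed
  then show ?thesis by (intro exI[of _ "R + m"]) auto
qed

section \<open>The quotient by reversal\<close>

definition reversal_class :: "'a list \<Rightarrow> 'a list set" where
  "reversal_class w = {w, rev w}"

lemma reversal_class_eq_iff: "reversal_class v = reversal_class w \<longleftrightarrow> v = w \<or> v = rev w"
  unfolding reversal_class_def by (auto simp: doubleton_eq_iff)

text \<open>A class has two elements, unless it consists of a single palindrome.\<close>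

lemma card_reversal_classes:
  assumes "finite S" and rev_closed: "\<And>w. w \<in> S \<Longrightarrow> rev w \<in> S"
  shows "2 * card (reversal_class ` S) = card S + card {w \<in> S. w = rev w}"
proof -
  define P where "P = {w \<in> S. w = rev w}"
  define Q where "Q = {w \<in> S. w \<noteq> rev w}"
  have fin: "finite P" "finite Q" using assms(1) by (auto simp: P_def Q_def)
  have S: "S = P \<union> Q" and PQ: "P \<inter> Q = {}" by (auto simp: P_def Q_def)
  have disj: "reversal_class ` P \<inter> reversal_class ` Q = {}"
    by (auto simp: P_def Q_def reversal_class_eq_iff)
  have cP: "card (reversal_class ` P) = card P"
    by (rule card_image) (auto simp: inj_on_def P_def reversal_class_eq_iff)
  have UQ: "\<Union> (reversal_class ` Q) = Q"
    using rev_closed by (auto simp: Q_def reversal_class_def)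
  have "2 * card (reversal_class ` Q) = card (\<Union> (reversal_class ` Q))"
  proof (rule card_partition)
    show "finite (\<Union> (reversal_class ` Q))" using fin UQ by simp
    show "card c = 2" if "c \<in> reversal_class ` Q" for c
      using that by (auto simp: Q_def reversal_class_def)
    show "c \<inter> d = {}"
      if "c \<in> reversal_class ` Q" "d \<in> reversal_class ` Q" "c \<noteq> d" for c d
      using that by (auto simp: reversal_class_def)
  qed (use fin in auto)
  then have cQ: "2 * card (reversal_class ` Q) = card Q" by (simp add: UQ)
  have "card (reversal_class ` S) = card (reversal_class ` P) + card (reversal_class ` Q)"
    unfolding S image_Un using fin disj by (intro card_Un_disjoint) auto
  moreover have "card S = card P + card Q"
    unfolding S using fin PQ by (rule card_Un_disjoint)
  ultimately show ?thesis using cP cQ unfolding P_def[symmetric] by simp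
qed

section \<open>Walks in undirected graphs\<close>

text \<open>
  This is the inequality between the numbers of vertices and of edges of a connected graph, for
  the part of a graph covered by the walk with vertices \<open>x 0, x 1, \<dots>\<close> and edges
  \<open>e 0, e 1, \<dots>\<close>. Whenever the walk meets a new vertex, the edge just traversed is not a loop and
  is new as well, because both endpoints of an edge traversed earlier have been seen. The
  hypothesis is that an edge determines its unordered pair of endpoints; parallel edges are
  allowed.
\<close>

lemma card_walk_vertices_le:
  assumes ends: "\<And>i j. e i = e j \<Longrightarrow> {x i, x (Suc i)} = {x j, x (Suc j)}"
  shows "card (x ` {..m}) \<le> Suc (card (e ` {i. i < m \<and> x i \<noteq> x (Suc i)}))"
proof (induction m)
  case 0
  show ?case by simp
next
  case (Suc m)
  let ?E = "\<lambda>m. e ` {i. i < m \<and> x i \<noteq> x (Suc i)}"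
  have sub: "?E m \<subseteq> ?E (Suc m)" and fin: "finite (?E (Suc m))" "finite (?E m)" by auto
  have V: "x ` {..Suc m} = insert (x (Suc m)) (x ` {..m})"
    by (simp add: atMost_Suc)
  show ?case
  proof (cases "x (Suc m) \<in> x ` {..m}")
    case True
    then show ?thesis
      using Suc card_mono[OF fin(1) sub] unfolding V by (simp add: insert_absorb)
  next
    case False
    have "e m \<notin> ?E m"
    proof
      assume "e m \<in> ?E m"
      then obtain i where "i < m" "e m = e i" by auto
      then have "x (Suc m) \<in> {x i, x (Suc i)}" using ends[of m i] by auto
      with \<open>i < m\<close> False show False by auto
    qed
    moreover have "insert (e m) (?E m) \<subseteq> ?E (Suc m)"
    proof -
      have "x m \<noteq> x (Suc m)" using False by (metis atMost_iff imageI le_refl)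
      then show ?thesis by auto
    qed
    ultimately have "Suc (card (?E m)) \<le> card (?E (Suc m))"
      using card_mono[OF fin(1), of "insert (e m) (?E m)"] fin(2) by simp
    then show ?thesis using Suc False unfolding V by simp
  qed
qed

lemma finite_range_eq_initial_image:
  fixes x :: "nat \<Rightarrow> 'v"
  assumes "finite (range x)"
  obtains m where "range x = x ` {..m}"
proof -
  obtain I where I: "finite I" "range x = x ` I"
    using finite_subset_image[OF assms, of x UNIV] by auto
  have "I \<subseteq> {..Max I}" using I(1) by auto
  then have "range x = x ` {..Max I}" using I(2) by blast
  then show ?thesis by (rule that)
qed

section \<open>The quotient of the Rauzy graph\<close>

text \<open>
  The endpoints of an edge \<open>f\<close> are \<open>butlast f\<close> and \<open>tl f\<close>. Passing from \<open>f\<close> to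
  \<open>rev f\<close> exchanges their classes, so edges and incidence descend to the quotient.
\<close>

lemma edge_class_determines_ends:
  assumes "reversal_class f = reversal_class g"
  shows "{reversal_class (butlast f), reversal_class (tl f)}
       = {reversal_class (butlast g), reversal_class (tl g)}"
proof -
  have "tl (rev g) = rev (butlast g)"
    using butlast_rev[of "rev g"] by simp
  then have swap: "reversal_class (butlast (rev g)) = reversal_class (tl g)"
    "reversal_class (tl (rev g)) = reversal_class (butlast g)"
    by (simp_all add: reversal_class_eq_iff)
  from assms have "f = g \<or> f = rev g" by (simp add: reversal_class_eq_iff)
  then show ?thesis using swap by auto
qed

lemma palindromic_edge_is_loop:
  assumes "f = rev f"
  shows "reversal_class (butlast f) = reversal_class (tl f)"
proof -
  have "butlast f = butlast (rev f)" using assms by (rule arg_cong)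
  then show ?thesis by (simp only: reversal_class_eq_iff butlast_rev simp_thms)
qed

text \<open>
  The occurrences of the factors of length \<open>n\<close> along \<open>u\<close>, taken up to reversal, form a walk
  through all vertices of the quotient graph; since there are finitely many vertices, an initial
  part of the walk already meets them all.
\<close>

lemma card_vertex_classes_le:
  assumes fin: "\<And>n. finite (factors u n)"
  shows "card (reversal_class ` factors u n)
       \<le> Suc (card (reversal_class ` {f \<in> factors u (Suc n). f \<noteq> rev f}))"
proof -
  define v where "v i = subsequence u i (i + n)" for i
  define f where "f i = subsequence u i (i + Suc n)" for i
  define x where "x i = reversal_class (v i)" for i
  define e where "e i = reversal_class (f i)" for i
  have "f i = v i @ [u (i + n)]" for i
    by (simp add: f_def v_def subsequence_def)
  moreover have "f i = u i # v (Suc i)" for i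
    by (simp add: f_def v_def subsequence_def upt_conv_Cons del: upt_Suc)
  ultimately have f_ends: "butlast (f i) = v i" "tl (f i) = v (Suc i)" for i
    by (metis butlast_snoc, metis list.sel(3))
  have V: "reversal_class ` factors u n = range x"
    by (auto simp: factors_eq_range x_def v_def)
  obtain m where m: "range x = x ` {..m}"
    using finite_range_eq_initial_image[of x] fin V by (metis finite_imageI)
  have "e i = e j \<Longrightarrow> {x i, x (Suc i)} = {x j, x (Suc j)}" for i j
    using edge_class_determines_ends[of "f i" "f j"] by (simp add: e_def x_def f_ends)
  then have "card (x ` {..m}) \<le> Suc (card (e ` {i. i < m \<and> x i \<noteq> x (Suc i)}))"
    by (rule card_walk_vertices_le)
  moreover
  have "e ` {i. i < m \<and> x i \<noteq> x (Suc i)}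
      \<subseteq> reversal_class ` {f \<in> factors u (Suc n). f \<noteq> rev f}"
  proof -
    have "f i \<noteq> rev (f i)" if "x i \<noteq> x (Suc i)" for i
      using palindromic_edge_is_loop[of "f i"] that by (auto simp: x_def f_ends)
    moreover have "f i \<in> factors u (Suc n)" for i
      by (auto simp: f_def factors_eq_range)
    ultimately show ?thesis by (auto simp: e_def)
  qed
  then have "card (e ` {i. i < m \<and> x i \<noteq> x (Suc i)})
      \<le> card (reversal_class ` {f \<in> factors u (Suc n). f \<noteq> rev f})"
    using fin[of "Suc n"] by (intro card_mono) auto
  ultimately show ?thesis
    unfolding V m by linarith
qed

theorem theorem1p2:
  fixes A :: "'a set" and u :: "'a word"
  assumes "finite A"
    and "\<And>n. u n \<in> A"
    and "uniformly_recurrent u"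
  shows "(\<not> closed_under_reversal (language u) \<longrightarrow>
           (\<exists>N. \<forall>n\<ge>N. palindromic_complexity u n = 0)) \<and>
         (closed_under_reversal (language u) \<longrightarrow>
           (\<forall>n. int (palindromic_complexity u n) + int (palindromic_complexity u (n + 1))
                  \<le> complexity_diff u n + 2))"
proof (intro conjI impI allI)
  assume "\<not> closed_under_reversal (language u)"
  then show "\<exists>N. \<forall>n\<ge>N. palindromic_complexity u n = 0"
    using eventually_no_palindromes[OF assms(3)]
    unfolding palindromic_complexity_def by (metis card.empty)
next
  fix n
  assume closed: "closed_under_reversal (language u)"
  have fin: "finite (factors u n)" for n
    by (rule finite_factors[OF assms(1,2)])
  let ?Q = "{f \<in> factors u (Suc n). f \<noteq> rev f}"
  let ?P = "{f \<in> factors u (Suc n). f = rev f}"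
  have "2 * card (reversal_class ` factors u n)
      = factor_complexity u n + palindromic_complexity u n"
    using card_reversal_classes[of "factors u n"] fin rev_mem_factors[OF closed]
    by (simp add: factor_complexity_def palindromic_complexity_def)
  moreover have "2 * card (reversal_class ` ?Q) = card ?Q"
  proof -
    have "{w \<in> ?Q. w = rev w} = {}" by auto
    moreover have "rev w \<in> ?Q" if "w \<in> ?Q" for w
      using that rev_mem_factors[OF closed] by auto
    ultimately show ?thesis
      using card_reversal_classes[of ?Q] fin[of "Suc n"] by (simp only: card.empty) simp
  qed
  moreover have "factor_complexity u (Suc n) = card ?Q + palindromic_complexity u (Suc n)"
  proof -
    have "factors u (Suc n) = ?Q \<union> ?P" by auto
    then have "card (factors u (Suc n)) = card (?Q \<union> ?P)" by (rule arg_cong)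
    also have "\<dots> = card ?Q + card ?P"
      using fin by (intro card_Un_disjoint) auto
    finally show ?thesis by (simp add: factor_complexity_def palindromic_complexity_def)
  qed
  moreover have "card (reversal_class ` factors u n) \<le> Suc (card (reversal_class ` ?Q))"
    by (rule card_vertex_classes_le[OF fin])
  ultimately show "int (palindromic_complexity u n) + int (palindromic_complexity u (n + 1))
      \<le> complexity_diff u n + 2"
    unfolding complexity_diff_def by simp
qed

end
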